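(* Let $(\lambda_n)_{n\geqslant1}$ and $(r_n)_{n\geqslant 1}$ be sequences of positive numbers and let $L$ be a non-negative random variable with moment generating function $\bar\ell(\gamma)=\mathbb{E}\,e^{\gamma L}$. For every $n\geqslant 1$ let $\gamma_n$ be the positive solution for $\gamma$ of \[\bar\ell(\gamma)\,\frac{\lambda_n}{\lambda_n+\gamma r_n}=1\] (assumed to exist). Suppose that $\gamma_n$ is non-increasing in $n$. Then, for all $n\geqslant 1$, $u>0$ and $t\geqslant 0$, the ruin probabilities defined in the context satisfy \[p_n(u,t)\leqslant p_n(u,\infty)\leqslant e^{-\gamma_n u}.\]
   Context: Model. At time $0$ there are $n$ obligors and the initial reserve is $u>0$. While $i\geqslant 1$ obligors have not yet defaulted, the reserve increases linearly at rate $r_i$, and the time until the next default is exponentially distributed with mean $\lambda_i^{-1}$. At each default the number of obligors decreases by one and the reserve decreases by a loss distributed as $L$. All inter-default times and losses are independent. When no obligors are left, the reserve no longer changes. $p_n(u,t)$ is the probability that ruin (the reserve dropping below zero) occurs at or before time $t$, starting with $n$ obligors and initial reserve $u$; $p_n(u,\infty)$ is the probability that ruin ever occurs. In particular $p_0(u,\cdot)=0$ for $u>0$. *)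

theory Defs
  imports "HOL-Probability.Probability"
begin

text \<open>
  Times and losses are indexed by the number of obligors still alive: while \<open>i\<close> obligors
  remain, the time to the next default is \<open>\<tau> i\<close>, and that default, which takes the
  number of obligors from \<open>i\<close> to \<open>i - 1\<close>, costs \<open>x i\<close>.
  The path is right-continuous: a loss is booked at the instant of the default.
\<close>

fun reserve ::
  "(nat \<Rightarrow> real) \<Rightarrow> (nat \<Rightarrow> real) \<Rightarrow> (nat \<Rightarrow> real) \<Rightarrow> nat \<Rightarrow> real \<Rightarrow> real \<Rightarrow> real" where
  "reserve r \<tau> x 0 u s = u"
| "reserve r \<tau> x (Suc i) u s =
     (if s < \<tau> (Suc i) then u + r (Suc i) * s
      else reserve r \<tau> x i (u + r (Suc i) * \<tau> (Suc i) - x (Suc i)) (s - \<tau> (Suc i)))"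

text \<open>The horizon \<open>t\<close> is extended real, \<open>t = \<infinity>\<close> being eventual ruin.\<close>

definition ruin_prob ::
  "'w measure \<Rightarrow> (nat \<Rightarrow> real) \<Rightarrow> (nat \<Rightarrow> 'w \<Rightarrow> real) \<Rightarrow> (nat \<Rightarrow> 'w \<Rightarrow> real)
     \<Rightarrow> nat \<Rightarrow> real \<Rightarrow> ereal \<Rightarrow> real" where
  "ruin_prob M r T X n u t =
     measure M {\<omega> \<in> space M. \<exists>s::real. 0 \<le> s \<and> ereal s \<le> t \<and>
       reserve r (\<lambda>i. T i \<omega>) (\<lambda>i. X i \<omega>) n u s < 0}"

text \<open>
  Where the moment generating function is infinite, the Bochner integral below is \<open>0\<close>.
  Such a \<open>g\<close> never satisfies an equation of the form \<open>mgf N L g * c = 1\<close>.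
\<close>

definition mgf :: "'v measure \<Rightarrow> ('v \<Rightarrow> real) \<Rightarrow> real \<Rightarrow> real" where
  "mgf N L g = (LINT y|N. exp (g * L y))"

end

theory Submission
  imports Defs
begin

text \<open>
  This is Lundberg's exponential supermartingale argument, run on the default epochs only and
  adapted to an exponent that changes from one epoch to the next.

  Between defaults the reserve rises, so it can first become negative only at a default. Let
  \<open>V\<^sub>d\<close> be the reserve just after the \<open>d\<close>-th default, frozen once it is negative. If all
  waiting times are positive, ruin implies \<open>V\<^sub>n < 0\<close> (\<open>ruin_imp_stopped_walk_negative\<close>). The
  increments \<open>Z\<^sub>d = r\<^sub>i T\<^sub>i - X\<^sub>i\<close>, where \<open>i = n - d\<close>, are independent, and the equation
  that defines \<open>\<gamma>\<^sub>i\<close> says exactly that \<open>E exp (- \<gamma>\<^sub>i Z\<^sub>d) = 1\<close>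
  (\<open>nn_integral_exp_increment\<close>).

  With a constant exponent \<open>\<gamma>\<close> the process \<open>exp (- \<gamma> V\<^sub>d)\<close> would be a martingale. Here
  the exponent \<open>c\<^sub>d = \<gamma>\<^sub>n\<^sub>-\<^sub>d\<close> grows with \<open>d\<close>, and raising it makes the exponential smaller
  where \<open>V\<^sub>d \<ge> 0\<close> but larger where \<open>V\<^sub>d < 0\<close>. The remedy is to truncate: the function
  \<open>min 1 (exp (- c v))\<close> equals \<open>1\<close> for every \<open>v < 0\<close> and so decreases in \<open>c\<close>
  everywhere, while a step of the frozen walk still does not increase its mean
  (\<open>truncated_exponential_step\<close>). Alternating the two facts from \<open>V\<^sub>0 = u\<close> up to
  \<open>V\<^sub>n\<close> gives \<open>P (V\<^sub>n < 0) \<le> exp (- c\<^sub>0 u)\<close>, and \<open>c\<^sub>0 = \<gamma>\<^sub>n\<close>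
  (\<open>lundberg_inequality_stopped_walk\<close>).

  Comparing the horizons \<open>t\<close> and \<open>\<infinity>\<close> is inclusion of events, once the larger event
  is known to be measurable.
\<close>

section \<open>The reserve path at the default epochs\<close>

lemma reserve_0:
  assumes "\<And>j. j \<in> {1..i} \<Longrightarrow> \<tau> j > 0"
  shows "reserve r \<tau> x i u 0 = u"
  using assms by (cases i) auto

text \<open>
  One default can be skipped without losing ruin. From a nonnegative level the path stays
  nonnegative until the default, so ruin has to happen afterwards; a negative level is kept as it
  is, and counts as ruined at time \<open>0\<close> because the remaining waiting times are
  positive.
\<close>

lemma reserve_negative_step:
  assumes \<tau>: "\<And>j. j \<in> {1..Suc i} \<Longrightarrow> \<tau> j > 0" and r: "r (Suc i) > 0"
    and s: "0 \<le> s" "reserve r \<tau> x (Suc i) u s < 0"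
  shows "\<exists>s'\<ge>0. reserve r \<tau> x i
           (if u < 0 then u else u + (r (Suc i) * \<tau> (Suc i) - x (Suc i))) s' < 0"
proof (cases "u < 0")
  case True
  then have "reserve r \<tau> x i u 0 < 0"
    using \<tau> by (subst reserve_0) auto
  with True show ?thesis by auto
next
  case False
  have "\<not> s < \<tau> (Suc i)"
  proof
    assume "s < \<tau> (Suc i)"
    then have "u + r (Suc i) * s < 0" using s by simp
    moreover have "r (Suc i) * s \<ge> 0" using r s by simp
    ultimately show False using False by linarith
  qed
  then show ?thesis
    using False s by (intro exI[of _ "s - \<tau> (Suc i)"]) (simp add: algebra_simps)
qed

text \<open>
  Freezing the walk at its first negative value lets ruin be read off from the final value
  alone, instead of from a minimum over the path.
\<close>

fun stopped_walk :: "(nat \<Rightarrow> real) \<Rightarrow> real \<Rightarrow> nat \<Rightarrow> real" where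
  "stopped_walk z u 0 = u"
| "stopped_walk z u (Suc d) =
     (if stopped_walk z u d < 0 then stopped_walk z u d else stopped_walk z u d + z d)"

text \<open>
  Step \<open>d\<close> of the walk, counted from \<open>0\<close>, is the default that finds \<open>n - d\<close> obligors
  alive; after \<open>n\<close> steps the reserve is constant, so ruin leaves no other possibility than a
  negative walk.
\<close>

lemma ruin_imp_stopped_walk_negative:
  fixes r \<tau> x :: "nat \<Rightarrow> real" and n :: nat
  defines "z \<equiv> \<lambda>d. r (n - d) * \<tau> (n - d) - x (n - d)"
  assumes \<tau>: "\<And>j. j \<in> {1..n} \<Longrightarrow> \<tau> j > 0" and r: "\<And>j. j \<in> {1..n} \<Longrightarrow> r j > 0"
    and s: "0 \<le> s" "reserve r \<tau> x n u s < 0"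
  shows "stopped_walk z u n < 0"
proof -
  have "\<exists>s\<ge>0. reserve r \<tau> x (n - d) (stopped_walk z u d) s < 0" if "d \<le> n" for d
    using that
  proof (induction d)
    case 0
    then show ?case using s by auto
  next
    case (Suc d)
    then have nd: "n - d = Suc (n - Suc d)" by simp
    obtain s' where "s' \<ge> 0" "reserve r \<tau> x (Suc (n - Suc d)) (stopped_walk z u d) s' < 0"
      using Suc unfolding nd by auto
    then have "\<exists>s\<ge>0. reserve r \<tau> x (n - Suc d) (if stopped_walk z u d < 0 then stopped_walk z u d
        else stopped_walk z u d + (r (n - d) * \<tau> (n - d) - x (n - d))) s < 0"
      unfolding nd using Suc.prems \<tau> r by (intro reserve_negative_step) auto
    moreover have "z d = r (n - d) * \<tau> (n - d) - x (n - d)" by (simp add: z_def)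
    ultimately show ?case by (simp only: stopped_walk.simps)
  qed
  from this[of n] show ?thesis by simp
qed

section \<open>Measurability of the ruin event\<close>

text \<open>
  An existential quantifier over real times does not preserve measurability by itself. Before the
  default the reserve rises, so the earliest admissible time \<open>a\<close> decides; after it the question
  is the same for one obligor less, with a shifted start. Starts other than \<open>0\<close> are
  needed because \<open>\<tau>\<close> may be negative: in a space that need not be complete, the null set of
  such outcomes cannot be dropped when measurability is at stake.
\<close>

lemma reserve_negative_after_Suc_iff:
  assumes "r (Suc i) > 0"
  shows "(\<exists>s\<ge>a. reserve r \<tau> x (Suc i) u s < 0) \<longleftrightarrow>
    (a < \<tau> (Suc i) \<and> u + r (Suc i) * a < 0) \<or>
    (\<exists>s\<ge>max a (\<tau> (Suc i)) - \<tau> (Suc i).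
       reserve r \<tau> x i (u + r (Suc i) * \<tau> (Suc i) - x (Suc i)) s < 0)"
    (is "?L \<longleftrightarrow> ?A \<or> ?B")
proof
  assume ?L
  then obtain s where s: "s \<ge> a" "reserve r \<tau> x (Suc i) u s < 0" by auto
  show "?A \<or> ?B"
  proof (cases "s < \<tau> (Suc i)")
    case True
    moreover have "r (Suc i) * a \<le> r (Suc i) * s" using s assms by simp
    ultimately have ?A using s by auto
    then show ?thesis ..
  next
    case False
    then have ?B using s by (intro exI[of _ "s - \<tau> (Suc i)"]) auto
    then show ?thesis ..
  qed
next
  assume "?A \<or> ?B"
  then show ?L
  proof
    assume ?A
    then show ?L by (intro exI[of _ a]) auto
  next
    assume ?B
    then obtain s where "s \<ge> max a (\<tau> (Suc i)) - \<tau> (Suc i)"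
      "reserve r \<tau> x i (u + r (Suc i) * \<tau> (Suc i) - x (Suc i)) s < 0" by auto
    then show ?L by (intro exI[of _ "s + \<tau> (Suc i)"]) auto
  qed
qed

lemma measurable_reserve_negative_after:
  fixes T X :: "nat \<Rightarrow> 'w \<Rightarrow> real" and U A :: "'w \<Rightarrow> real"
  assumes "\<And>j. j \<in> {1..i} \<Longrightarrow> r j > 0"
    and "\<And>j. j \<in> {1..i} \<Longrightarrow> T j \<in> borel_measurable M"
    and "\<And>j. j \<in> {1..i} \<Longrightarrow> X j \<in> borel_measurable M"
    and "U \<in> borel_measurable M" "A \<in> borel_measurable M"
  shows "Measurable.pred M
    (\<lambda>\<omega>. \<exists>s\<ge>A \<omega>. reserve r (\<lambda>i. T i \<omega>) (\<lambda>i. X i \<omega>) i (U \<omega>) s < 0)"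
  using assms
proof (induction i arbitrary: U A)
  case 0
  have "(\<lambda>\<omega>. \<exists>s\<ge>A \<omega>. reserve r (\<lambda>i. T i \<omega>) (\<lambda>i. X i \<omega>) 0 (U \<omega>) s < 0) = (\<lambda>\<omega>. U \<omega> < 0)"
    by (auto simp: fun_eq_iff)
  then show ?case using 0 by simp
next
  case (Suc i)
  have [measurable]: "T (Suc i) \<in> borel_measurable M" "X (Suc i) \<in> borel_measurable M"
    "U \<in> borel_measurable M" "A \<in> borel_measurable M"
    using Suc.prems by auto
  have [measurable]: "Measurable.pred M
    (\<lambda>\<omega>. \<exists>s\<ge>max (A \<omega>) (T (Suc i) \<omega>) - T (Suc i) \<omega>.
       reserve r (\<lambda>i. T i \<omega>) (\<lambda>i. X i \<omega>) i (U \<omega> + r (Suc i) * T (Suc i) \<omega> - X (Suc i) \<omega>) s < 0)"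
    using Suc.prems by (intro Suc.IH) auto
  have "r (Suc i) > 0" using Suc.prems(1) by auto
  then show ?case
    by (subst reserve_negative_after_Suc_iff) auto
qed

section \<open>Lundberg's inequality for a walk with varying increments\<close>

lemma (in prob_space) indep_var_nn_integral_mult:
  fixes A B :: "'a \<Rightarrow> ennreal"
  assumes "indep_var borel A borel B"
  shows "(\<integral>\<^sup>+\<omega>. A \<omega> * B \<omega> \<partial>M) = (\<integral>\<^sup>+\<omega>. A \<omega> \<partial>M) * (\<integral>\<^sup>+\<omega>. B \<omega> \<partial>M)"
proof -
  have "indep_vars (\<lambda>_. borel) (case_bool A B) UNIV"
    using assms unfolding indep_var_def
    by (subst indep_vars_cong[OF refl refl]) (auto split: bool.split)
  from indep_vars_nn_integral[OF _ this] show ?thesis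
    by (simp add: UNIV_bool mult.commute)
qed

text \<open>
  On \<open>V < 0\<close> the walk is frozen and both integrands are \<open>1\<close>. On \<open>V \<ge> 0\<close> the truncation is void on
  the right and may be dropped on the left, where independence splits off the factor
  \<open>E exp (- c Z) \<le> 1\<close>.
\<close>

lemma (in prob_space) truncated_exponential_step:
  fixes V Z :: "'a \<Rightarrow> real"
  assumes indep: "indep_var borel V borel Z" and c: "c > 0"
    and Z: "(\<integral>\<^sup>+\<omega>. exp (- c * Z \<omega>) \<partial>M) \<le> 1"
  shows "(\<integral>\<^sup>+\<omega>. min 1 (exp (- c * (if V \<omega> < 0 then V \<omega> else V \<omega> + Z \<omega>))) \<partial>M)
       \<le> (\<integral>\<^sup>+\<omega>. min 1 (exp (- c * V \<omega>)) \<partial>M)"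
proof -
  note [measurable] = indep_var_rv1[OF indep] indep_var_rv2[OF indep]
  let ?N = "\<lambda>v. if v < 0 then 1 else 0 :: ennreal"
  let ?P = "\<lambda>v. if v < 0 then 0 else ennreal (exp (- c * v))"
  have "indep_var borel (?P \<circ> V) borel ((\<lambda>z. ennreal (exp (- c * z))) \<circ> Z)"
    by (rule indep_var_compose[OF indep]) measurable
  from indep_var_nn_integral_mult[OF this]
  have prod: "(\<integral>\<^sup>+\<omega>. ?P (V \<omega>) * exp (- c * Z \<omega>) \<partial>M)
      = (\<integral>\<^sup>+\<omega>. ?P (V \<omega>) \<partial>M) * (\<integral>\<^sup>+\<omega>. exp (- c * Z \<omega>) \<partial>M)"
    by (simp add: comp_def)
  have "(\<integral>\<^sup>+\<omega>. min 1 (exp (- c * (if V \<omega> < 0 then V \<omega> else V \<omega> + Z \<omega>))) \<partial>M)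
      \<le> (\<integral>\<^sup>+\<omega>. ?N (V \<omega>) + ?P (V \<omega>) * exp (- c * Z \<omega>) \<partial>M)"
    by (intro nn_integral_mono)
       (auto simp: ennreal_mult[symmetric] exp_add[symmetric] algebra_simps
             intro!: ennreal_leI simp flip: ennreal_1)
  also have "\<dots> = (\<integral>\<^sup>+\<omega>. ?N (V \<omega>) \<partial>M) + (\<integral>\<^sup>+\<omega>. ?P (V \<omega>) * exp (- c * Z \<omega>) \<partial>M)"
    by (rule nn_integral_add) measurable
  also have "\<dots> \<le> (\<integral>\<^sup>+\<omega>. ?N (V \<omega>) \<partial>M) + (\<integral>\<^sup>+\<omega>. ?P (V \<omega>) \<partial>M)"
    unfolding prod using mult_left_mono[OF Z] by (intro add_left_mono) simp
  also have "\<dots> = (\<integral>\<^sup>+\<omega>. ?N (V \<omega>) + ?P (V \<omega>) \<partial>M)"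
    by (rule nn_integral_add[symmetric]) measurable
  also have "\<dots> = (\<integral>\<^sup>+\<omega>. min 1 (exp (- c * V \<omega>)) \<partial>M)"
  proof (intro nn_integral_cong)
    fix \<omega>
    have "V \<omega> < 0 \<Longrightarrow> c * V \<omega> \<le> 0" "\<not> V \<omega> < 0 \<Longrightarrow> c * V \<omega> \<ge> 0"
      using c by (auto intro: mult_nonneg_nonpos)
    then show "?N (V \<omega>) + ?P (V \<omega>) = min 1 (exp (- c * V \<omega>))"
      by (auto simp: min_def)
  qed
  finally show ?thesis .
qed

lemma measurable_stopped_walk [measurable]:
  assumes "{..<d} \<subseteq> D"
  shows "(\<lambda>z. stopped_walk z u d) \<in> borel_measurable (PiM D (\<lambda>_. borel))"
  using assms
proof (induction d)
  case (Suc d)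
  have [measurable]: "(\<lambda>z. stopped_walk z u d) \<in> borel_measurable (PiM D (\<lambda>_. borel))"
    using Suc.prems by (intro Suc.IH) auto
  have [simp]: "d \<in> D" using Suc.prems by auto
  show ?case by simp
qed simp

text \<open>
  Only the first \<open>d\<close> increments enter the first \<open>d\<close> steps; hence, for independent
  increments, the walk is independent of its next one.
\<close>

lemma stopped_walk_restrict: "stopped_walk (restrict z {..<d}) u d = stopped_walk z u d"
proof -
  have "stopped_walk (restrict z {..<d}) u e = stopped_walk z u e" if "e \<le> d" for e
    using that by (induction e) auto
  then show ?thesis by simp
qed

text \<open>
  The truncated mean is taken with the exponent \<open>c d\<close> both before and after step \<open>d\<close>; only then
  is the exponent raised to \<open>c (Suc d)\<close>, which lowers the truncated exponential pointwise.
  So the initial exponent \<open>c 0\<close>, the weakest one, is what survives in the bound.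
\<close>

theorem (in prob_space) lundberg_inequality_stopped_walk:
  fixes Z :: "nat \<Rightarrow> 'a \<Rightarrow> real" and c :: "nat \<Rightarrow> real"
  assumes indep: "indep_vars (\<lambda>_. borel) Z {..<n}"
    and c_pos: "\<And>d. d < n \<Longrightarrow> c d > 0"
    and c_mono: "\<And>d e. d \<le> e \<Longrightarrow> e < n \<Longrightarrow> c d \<le> c e"
    and Z: "\<And>d. d < n \<Longrightarrow> (\<integral>\<^sup>+\<omega>. exp (- c d * Z d \<omega>) \<partial>M) \<le> 1"
    and n: "n > 0"
  shows "prob {\<omega> \<in> space M. stopped_walk (\<lambda>d. Z d \<omega>) u n < 0} \<le> exp (- c 0 * u)"
proof -
  define V where "V d \<omega> = stopped_walk (\<lambda>d. Z d \<omega>) u d" for d \<omega>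
  have V_indep: "indep_var borel (V d) borel (Z d)" if "d < n" for d
  proof -
    have "indep_var borel ((\<lambda>z. stopped_walk z u d) \<circ> (\<lambda>\<omega>. restrict (\<lambda>i. Z i \<omega>) {..<d}))
        borel ((\<lambda>z. z d) \<circ> (\<lambda>\<omega>. restrict (\<lambda>i. Z i \<omega>) {d}))"
      by (rule indep_var_compose[OF indep_var_restrict[OF indep]]) (use that in auto)
    then show ?thesis by (simp add: comp_def V_def[abs_def] stopped_walk_restrict)
  qed
  have V_Suc: "V (Suc d) \<omega> = (if V d \<omega> < 0 then V d \<omega> else V d \<omega> + Z d \<omega>)" for d \<omega>
    by (simp add: V_def)
  have step: "(\<integral>\<^sup>+\<omega>. min 1 (exp (- c d * V (Suc d) \<omega>)) \<partial>M)
      \<le> (\<integral>\<^sup>+\<omega>. min 1 (exp (- c d * V d \<omega>)) \<partial>M)" if "d < n" for d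
    unfolding V_Suc using that by (intro truncated_exponential_step V_indep c_pos Z)
  have bound: "(\<integral>\<^sup>+\<omega>. min 1 (exp (- c d * V (Suc d) \<omega>)) \<partial>M) \<le> exp (- c 0 * u)"
    if "d < n" for d
    using that
  proof (induction d)
    case 0
    have "(\<integral>\<^sup>+\<omega>. min 1 (exp (- c 0 * V 0 \<omega>)) \<partial>M) \<le> (\<integral>\<^sup>+\<omega>. exp (- c 0 * u) \<partial>M)"
      by (intro nn_integral_mono) (simp add: V_def)
    also have "\<dots> = exp (- c 0 * u)"
      by (simp add: emeasure_space_1)
    finally show ?case using step[OF 0] by (rule order_trans[rotated])
  next
    case (Suc d)
    have "min 1 (exp (- c (Suc d) * v)) \<le> min 1 (exp (- c d * v))" for v
    proof (cases "v < 0")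
      case True
      then have "c d * v \<le> 0"
        using c_pos[of d] Suc.prems by (intro mult_nonneg_nonpos) auto
      then show ?thesis by (auto simp: min_def)
    next
      case False
      then have "c d * v \<le> c (Suc d) * v"
        using c_mono[of d "Suc d"] Suc.prems by (intro mult_right_mono) auto
      then show ?thesis by (intro min.mono) auto
    qed
    then have "(\<integral>\<^sup>+\<omega>. min 1 (exp (- c (Suc d) * V (Suc d) \<omega>)) \<partial>M)
        \<le> (\<integral>\<^sup>+\<omega>. min 1 (exp (- c d * V (Suc d) \<omega>)) \<partial>M)"
      by (intro nn_integral_mono ennreal_leI)
    with step[OF Suc.prems] Suc show ?case by (meson Suc_lessD order_trans)
  qed
  obtain m where m: "n = Suc m" using n by (cases n) auto
  have V_meas: "V n \<in> borel_measurable M"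
  proof -
    have [measurable]: "V m \<in> borel_measurable M" "Z m \<in> borel_measurable M"
      using V_indep[of m] indep_var_rv1 indep_var_rv2 m by auto
    show ?thesis unfolding m V_Suc[abs_def] by measurable
  qed
  have "emeasure M {\<omega> \<in> space M. V n \<omega> < 0} = (\<integral>\<^sup>+\<omega>. indicator {\<omega> \<in> space M. V n \<omega> < 0} \<omega> \<partial>M)"
    using V_meas by simp
  also have "\<dots> \<le> (\<integral>\<^sup>+\<omega>. min 1 (exp (- c m * V (Suc m) \<omega>)) \<partial>M)"
  proof (intro nn_integral_mono)
    fix \<omega>
    have "V n \<omega> < 0 \<Longrightarrow> c m * V n \<omega> \<le> 0"
      using c_pos[of m] m by (intro mult_nonneg_nonpos) auto
    then show "indicator {\<omega> \<in> space M. V n \<omega> < 0} \<omega> \<le> ennreal (min 1 (exp (- c m * V (Suc m) \<omega>)))"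
      by (auto simp: indicator_def m min_def)
  qed
  also have "\<dots> \<le> exp (- c 0 * u)" using bound[of m] m by simp
  finally show ?thesis
    by (simp add: emeasure_eq_measure V_def)
qed

section \<open>Exponential moments of the increments\<close>

text \<open>
  Tilting the exponential density with rate \<open>l\<close> by \<open>exp (- c y)\<close> gives, up to the factor
  \<open>l / (l + c)\<close>, the exponential density with rate \<open>l + c\<close>, whose mass is \<open>1\<close>.
\<close>

lemma (in prob_space) exponential_laplace_transform:
  assumes D: "distributed M lborel S (exponential_density l)" and l: "l > 0" and c: "c \<ge> 0"
  shows "(\<integral>\<^sup>+\<omega>. exp (- c * S \<omega>) \<partial>M) = l / (l + c)"
proof -
  interpret E: prob_space "density lborel (exponential_density (l + c))"
    using l c by (intro prob_space_exponential_density) simp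
  have "(\<integral>\<^sup>+\<omega>. exp (- c * S \<omega>) \<partial>M)
      = (\<integral>\<^sup>+y. ennreal (exponential_density l y) * ennreal (exp (- c * y)) \<partial>lborel)"
    by (rule distributed_nn_integral[OF D, symmetric]) simp
  also have "\<dots> = (\<integral>\<^sup>+y. ennreal (l / (l + c)) * ennreal (exponential_density (l + c) y) \<partial>lborel)"
    using l c
    by (intro nn_integral_cong)
       (auto simp: exponential_density_def ennreal_mult[symmetric] exp_add[symmetric]
             right_diff_distrib distrib_left mult.commute)
  also have "\<dots> = ennreal (l / (l + c)) * (\<integral>\<^sup>+y. exponential_density (l + c) y \<partial>lborel)"
    by (rule nn_integral_cmult) simp
  also have "(\<integral>\<^sup>+y. ennreal (exponential_density (l + c) y) \<partial>lborel) = 1"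
    using E.emeasure_space_1 by (simp add: emeasure_density)
  finally show ?thesis by simp
qed

text \<open>
  A nonzero Bochner integral certifies integrability, so here \<open>mgf\<close> is the true moment
  generating function rather than the default value.
\<close>

lemma nn_integral_exp_eq_mgf:
  assumes "mgf N L g \<noteq> 0"
  shows "(\<integral>\<^sup>+y. exp (g * L y) \<partial>N) = mgf N L g"
proof -
  have "integrable N (\<lambda>y. exp (g * L y))"
    using assms not_integrable_integral_eq unfolding mgf_def by blast
  then show ?thesis unfolding mgf_def by (intro nn_integral_eq_integral) auto
qed

text \<open>
  By independence the exponential moment of \<open>\<rho> S - Y\<close> is the Laplace transform of \<open>S\<close> at
  \<open>g \<rho>\<close> times the moment generating function of \<open>Y\<close> at \<open>g\<close>: the left-hand side of the
  equation for the adjustment coefficient.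
\<close>

lemma (in prob_space) nn_integral_exp_increment:
  fixes S Y :: "'a \<Rightarrow> real" and L :: "'v \<Rightarrow> real"
  assumes S: "distributed M lborel S (exponential_density l)" and l: "l > 0"
    and Y: "distr M borel Y = distr N borel L" and L: "L \<in> borel_measurable N"
    and indep: "indep_var borel S borel Y"
    and g: "g > 0" and \<rho>: "\<rho> > 0" and root: "mgf N L g * (l / (l + g * \<rho>)) = 1"
  shows "(\<integral>\<^sup>+\<omega>. exp (- g * (\<rho> * S \<omega> - Y \<omega>)) \<partial>M) = 1"
proof -
  note [measurable] = indep_var_rv1[OF indep] indep_var_rv2[OF indep] L
  have "indep_var borel ((\<lambda>s. ennreal (exp (- (g * \<rho>) * s))) \<circ> S)
      borel ((\<lambda>y. ennreal (exp (g * y))) \<circ> Y)"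
    by (rule indep_var_compose[OF indep]) measurable
  from indep_var_nn_integral_mult[OF this]
  have "(\<integral>\<^sup>+\<omega>. exp (- (g * \<rho>) * S \<omega>) * ennreal (exp (g * Y \<omega>)) \<partial>M)
      = (\<integral>\<^sup>+\<omega>. exp (- (g * \<rho>) * S \<omega>) \<partial>M) * (\<integral>\<^sup>+\<omega>. exp (g * Y \<omega>) \<partial>M)"
    by (simp add: comp_def)
  also have "(\<integral>\<^sup>+\<omega>. exp (- (g * \<rho>) * S \<omega>) \<partial>M) = l / (l + g * \<rho>)"
    using g \<rho> by (intro exponential_laplace_transform[OF S l]) simp
  also have "(\<integral>\<^sup>+\<omega>. exp (g * Y \<omega>) \<partial>M) = (\<integral>\<^sup>+y. exp (g * y) \<partial>distr M borel Y)"
    by (subst nn_integral_distr) auto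
  also have "\<dots> = (\<integral>\<^sup>+y. exp (g * L y) \<partial>N)"
    unfolding Y by (subst nn_integral_distr) auto
  also have "\<dots> = mgf N L g"
    using root by (intro nn_integral_exp_eq_mgf) (metis mult_zero_left zero_neq_one)
  also have "ennreal (l / (l + g * \<rho>)) * ennreal (mgf N L g) = ennreal (l / (l + g * \<rho>) * mgf N L g)"
    using g \<rho> l by (intro ennreal_mult'[symmetric]) simp
  also have "l / (l + g * \<rho>) * mgf N L g = 1"
    by (subst mult.commute) (rule root)
  finally show ?thesis
    by (simp add: ennreal_mult[symmetric] exp_add[symmetric] algebra_simps)
qed

theorem theorem3p3:
  fixes M :: "'w measure" and N :: "'v measure"
    and T X :: "nat \<Rightarrow> 'w \<Rightarrow> real" and L :: "'v \<Rightarrow> real"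
    and lam r \<gamma> :: "nat \<Rightarrow> real"
    and n :: nat and u t :: real
  assumes lam_pos: "\<And>i. i \<ge> 1 \<Longrightarrow> lam i > 0"
    and r_pos: "\<And>i. i \<ge> 1 \<Longrightarrow> r i > 0"
    and N_prob: "prob_space N"
    and L_measurable: "L \<in> borel_measurable N"
    and L_nonneg: "AE y in N. L y \<ge> 0"
    and gamma_pos: "\<And>i. i \<ge> 1 \<Longrightarrow> \<gamma> i > 0"
    and gamma_solves: "\<And>i. i \<ge> 1 \<Longrightarrow> mgf N L (\<gamma> i) * (lam i / (lam i + \<gamma> i * r i)) = 1"
    and gamma_noninc: "\<And>i j. 1 \<le> i \<Longrightarrow> i \<le> j \<Longrightarrow> \<gamma> j \<le> \<gamma> i"
    and M_prob: "prob_space M"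
    and times_exponential:
      "\<And>i. i \<in> {1..n} \<Longrightarrow> distributed M lborel (T i) (exponential_density (lam i))"
    and losses_distr:
      "\<And>i. i \<in> {1..n} \<Longrightarrow> distr M borel (X i) = distr N borel L"
    and indep:
      "prob_space.indep_vars M (\<lambda>_. borel) (case_sum T X) ({1..n} <+> {1..n})"
    and n_pos: "n \<ge> 1" and u_pos: "u > 0" and t_nonneg: "t \<ge> 0"
  shows "ruin_prob M r T X n u (ereal t) \<le> ruin_prob M r T X n u \<infinity> \<and>
         ruin_prob M r T X n u \<infinity> \<le> exp (- \<gamma> n * u)"
proof -
  interpret prob_space M by (rule M_prob)
  have X_meas: "X i \<in> borel_measurable M" if "i \<in> {1..n}" for i
    using indep that unfolding indep_vars_def2 by (auto dest!: bspec[of _ _ "Inr i"])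
  have T_meas: "T i \<in> borel_measurable M" if "i \<in> {1..n}" for i
    using distributed_measurable[OF times_exponential[OF that]] by simp
  define B where "B = {\<omega> \<in> space M. \<exists>s\<ge>0. reserve r (\<lambda>i. T i \<omega>) (\<lambda>i. X i \<omega>) n u s < 0}"
  have B: "B \<in> events"
    using measurable_reserve_negative_after[of n r T M X "\<lambda>_. u" "\<lambda>_. 0"] r_pos T_meas X_meas
    unfolding B_def pred_def by simp
  have ruin_B: "ruin_prob M r T X n u \<infinity> = prob B"
    by (simp add: ruin_prob_def B_def)
  have "ruin_prob M r T X n u (ereal t) \<le> ruin_prob M r T X n u \<infinity>"
    unfolding ruin_B unfolding ruin_prob_def
    by (rule finite_measure_mono[OF _ B]) (auto simp: B_def)
  moreover have "prob B \<le> exp (- \<gamma> n * u)"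
  proof -
    define Z where "Z d \<omega> = r (n - d) * T (n - d) \<omega> - X (n - d) \<omega>" for d \<omega>
    have Z_indep: "indep_vars (\<lambda>_. borel) Z {..<n}"
    proof -
      have "indep_vars (\<lambda>d. PiM {Inl (n - d), Inr (n - d)} (\<lambda>_. borel))
          (\<lambda>d \<omega>. restrict (\<lambda>j. case_sum T X j \<omega>) {Inl (n - d), Inr (n - d)}) {..<n}"
        by (rule indep_vars_restrict[OF indep]) (auto simp: disjoint_family_on_def)
      then have "indep_vars (\<lambda>_. borel) (\<lambda>d. (\<lambda>f. r (n - d) * f (Inl (n - d)) - f (Inr (n - d))) \<circ>
          (\<lambda>\<omega>. restrict (\<lambda>j. case_sum T X j \<omega>) {Inl (n - d), Inr (n - d)})) {..<n}"
        by (rule indep_vars_compose) measurable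
      then show ?thesis by (simp add: comp_def Z_def[abs_def])
    qed
    have TX_indep: "indep_var borel (T i) borel (X i)" if "i \<in> {1..n}" for i
    proof -
      have "indep_var borel ((\<lambda>f. f (Inl i)) \<circ> (\<lambda>\<omega>. restrict (\<lambda>j. case_sum T X j \<omega>) {Inl i}))
          borel ((\<lambda>f. f (Inr i)) \<circ> (\<lambda>\<omega>. restrict (\<lambda>j. case_sum T X j \<omega>) {Inr i}))"
        by (rule indep_var_compose[OF indep_var_restrict[OF indep]]) (use that in auto)
      then show ?thesis by (simp add: comp_def)
    qed
    have "(\<integral>\<^sup>+\<omega>. exp (- \<gamma> (n - d) * Z d \<omega>) \<partial>M) = 1" if "d < n" for d
      unfolding Z_def using that
      by (intro nn_integral_exp_increment[OF times_exponential _ losses_distr L_measurable TX_indep]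
            lam_pos gamma_pos r_pos gamma_solves) auto
    \<comment> \<open>The exponent of step \<open>d\<close> is \<open>\<gamma> (n - d)\<close>, which is nondecreasing in \<open>d\<close>.\<close>
    then have lundberg: "prob {\<omega> \<in> space M. stopped_walk (\<lambda>d. Z d \<omega>) u n < 0} \<le> exp (- \<gamma> (n - 0) * u)"
      using n_pos by (intro lundberg_inequality_stopped_walk[OF Z_indep]) (auto intro: gamma_pos gamma_noninc)
    have T_pos: "AE \<omega> in M. \<forall>i\<in>{1..n}. T i \<omega> > 0"
    proof (intro AE_finite_allI)
      fix i assume i: "i \<in> {1..n}"
      have "prob {\<omega> \<in> space M. 0 < T i \<omega>} = 1"
        using exponential_distributedD_gt[OF times_exponential[OF i], of 0] lam_pos i by simp
      then show "AE \<omega> in M. T i \<omega> > 0"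
        using prob_eq_1[of "{\<omega> \<in> space M. 0 < T i \<omega>}"] T_meas[OF i] by auto
    qed simp
    have "prob B \<le> prob {\<omega> \<in> space M. stopped_walk (\<lambda>d. Z d \<omega>) u n < 0}"
    proof (rule finite_measure_mono_AE)
      show "AE \<omega> in M. \<omega> \<in> B \<longrightarrow> \<omega> \<in> {\<omega> \<in> space M. stopped_walk (\<lambda>d. Z d \<omega>) u n < 0}"
        using T_pos
      proof eventually_elim
        case (elim \<omega>)
        then show ?case
          using ruin_imp_stopped_walk_negative[of n "\<lambda>i. T i \<omega>" r _ "\<lambda>i. X i \<omega>" u] r_pos
          by (auto simp: B_def Z_def)
      qed
    next
      have "(\<lambda>z. stopped_walk z u n) \<circ> (\<lambda>\<omega>. restrict (\<lambda>d. Z d \<omega>) {..<n}) \<in> borel_measurable M"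
        using Z_indep
        by (intro measurable_comp[OF measurable_restrict measurable_stopped_walk])
           (auto simp: indep_vars_def2)
      then show "{\<omega> \<in> space M. stopped_walk (\<lambda>d. Z d \<omega>) u n < 0} \<in> events"
        by (simp add: comp_def stopped_walk_restrict)
    qed
    also note lundberg
    finally show ?thesis by simp
  qed
  ultimately show ?thesis unfolding ruin_B by simp
qed

end
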